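(* Let $\beta$ be a unit-speed timelike curve in $\mathbb{E}^4_1$ with Frenet frame $\{F_1,F_2,F_3,F_4\}$, let $r>0$ be constant, and let $M$ be the tubular hypersurface $$\mathcal{T}(s,t,w)=\beta(s)+r(\cos t\cos w\,F_2(s)+\sin t\cos w\,F_3(s)+\sin w\,F_4(s))$$ in $\mathbb{E}^4_1$, with Gauss map $N=-(\cos t\cos w\,F_2+\sin t\cos w\,F_3+\sin w\,F_4)$. Then $M$ does not have generalized $\mathcal{L}_1$ 1-type Gauss map; that is, there do not exist non-zero smooth functions $\mathfrak{m},\mathfrak{n}$ on $M$ and a non-zero constant vector $C\in\mathbb{E}^4_1$ such that $\mathcal{L}_1N=\mathfrak{m}N+\mathfrak{n}C$.
   Context: $\mathbb{E}^4_1$ is $\mathbb{R}^4$ with the metric $\langle\ ,\ \rangle=-dx_1^2+dx_2^2+dx_3^2+dx_4^2$. The curve $\beta:I\to\mathbb{E}^4_1$ ($I$ an open interval) is smooth with $\beta'=F_1$, and $\{F_1,F_2,F_3,F_4\}$ is a smooth orthonormal frame along $\beta$ with $\langle F_1,F_1\rangle=-1$, $\langle F_i,F_i\rangle=1$ ($i=2,3,4$), satisfying the Frenet equations $F_1'=k_1F_2$, $F_2'=k_1F_1+k_2F_3$, $F_3'=-k_2F_2+k_3F_4$, $F_4'=-k_3F_3$, where $k_1,k_2,k_3$ are smooth functions of $s$ (the curvatures of $\beta$). The parameters $(s,t,w)$ range over a connected open set $U\subset I\times\mathbb{R}^2$ projecting onto $I$ on which $\mathcal{T}$ is an immersion, i.e.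 $\cos w\neq0$ and $1+rk_1\cos t\cos w\neq0$. The unit normal $N$ has $\varepsilon=\langle N,N\rangle=1$, and the principal curvatures with respect to $N$ (eigenvalues of the shape operator $-dN$) are $\kappa_1=\kappa_2=\frac1r$, $\kappa_3=\frac{k_1\cos t\cos w}{1+rk_1\cos t\cos w}$. Operator $\mathcal{L}_1$ (Cheng–Yau) on the Gauss map: put $a_1=-\sum_i\kappa_i$, $a_k=(-1)^k\sum_{i_1<\dots<i_k}\kappa_{i_1}\cdots\kappa_{i_k}$ ($k=2,3$), and define $H_k$ by $\binom{3}{k}H_k=(-\varepsilon)^ka_k$. Then $$\mathcal{L}_1N=-\varepsilon\,\mathfrak{C}_1\big(\nabla H_2+(3H_1H_2-H_3)N\big),\qquad \mathfrak{C}_1=\binom32(-\varepsilon)=-3\varepsilon,$$ where $\nabla$ is the gradient on $M$ with respect to the induced metric, viewed as an $\mathbb{E}^4_1$-valued map. "Non-zero function" means not identically zero. *)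

theory Defs
  imports "HOL-Analysis.Analysis"
begin

section \<open>Smooth maps on open sets\<close>

text \<open>Class \<open>C\<^sup>k\<close> by iterated directional derivatives; to be used with open \<open>S\<close>.
  As \<open>v\<close> ranges over all directions, the recursion controls all mixed partial derivatives.\<close>

primrec Ck_on :: "nat \<Rightarrow> 'a::euclidean_space set \<Rightarrow> ('a \<Rightarrow> 'b::real_normed_vector) \<Rightarrow> bool" where
  "Ck_on 0 S f \<longleftrightarrow> continuous_on S f"
| "Ck_on (Suc k) S f \<longleftrightarrow> (\<forall>x\<in>S. f differentiable (at x)) \<and>
     (\<forall>v. Ck_on k S (\<lambda>x. frechet_derivative f (at x) v))"

definition smooth_on :: "'a::euclidean_space set \<Rightarrow> ('a \<Rightarrow> 'b::real_normed_vector) \<Rightarrow> bool" where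
  "smooth_on S f \<longleftrightarrow> (\<forall>k. Ck_on k S f)"


section \<open>Parametrized hypersurfaces of Minkowski 4-space\<close>

definition lorentz :: "real^4 \<Rightarrow> real^4 \<Rightarrow> real" where
  "lorentz x y = - (x$1 * y$1) + x$2 * y$2 + x$3 * y$3 + x$4 * y$4"

text \<open>A hypersurface is given by an immersion \<open>X\<close> of an open set \<open>U\<close> of parameters, and functions
  and vector fields along it are functions of the parameter. The tangent space at \<open>p\<close> is the range
  of the differential of \<open>X\<close> at \<open>p\<close>. The induced metric need not be Riemannian.\<close>

definition immersion_on :: "(real^3) set \<Rightarrow> (real^3 \<Rightarrow> real^4) \<Rightarrow> bool" where
  "immersion_on U X \<longleftrightarrow> smooth_on U X \<and> (\<forall>p\<in>U. inj (frechet_derivative X (at p)))"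

text \<open>The gradient of \<open>h\<close> is the tangent vector \<open>dX v\<close> with \<open>\<langle>dX v, dX u\<rangle> = dh u\<close> for all \<open>u\<close>; such \<open>v\<close>
  is unique when the induced metric is nondegenerate.\<close>

definition hgrad :: "(real^3 \<Rightarrow> real^4) \<Rightarrow> (real^3 \<Rightarrow> real) \<Rightarrow> real^3 \<Rightarrow> real^4" where
  "hgrad X h p = frechet_derivative X (at p)
     (THE v. \<forall>u. lorentz (frechet_derivative X (at p) v) (frechet_derivative X (at p) u)
                  = frechet_derivative h (at p) u)"

text \<open>The shape operator \<open>-dN\<close>, as an endomorphism of the tangent space that is transported to the
  parameter space by \<open>dX\<close>: it sends \<open>v\<close> to the \<open>w\<close> with \<open>dX w = - dN v\<close>.\<close>

definition shape_operator :: "(real^3 \<Rightarrow> real^4) \<Rightarrow> (real^3 \<Rightarrow> real^4) \<Rightarrow> real^3 \<Rightarrow> real^3 \<Rightarrow> real^3" where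
  "shape_operator X N p v =
     (THE w. frechet_derivative X (at p) w = - frechet_derivative N (at p) v)"

text \<open>The three eigenvalues, counted with multiplicity. Their order is left unspecified, and only
  symmetric functions of them are used. The choice is meaningful whenever the characteristic
  polynomial splits over the reals.\<close>

definition principal_curvatures :: "(real^3 \<Rightarrow> real^4) \<Rightarrow> (real^3 \<Rightarrow> real^4) \<Rightarrow> real^3 \<Rightarrow> 3 \<Rightarrow> real" where
  "principal_curvatures X N p =
     (SOME \<kappa>. \<forall>x::real. det (mat x - matrix (shape_operator X N p)) = (\<Prod>i\<in>UNIV. x - \<kappa> i))"

definition curv_coeff :: "(real^3 \<Rightarrow> real^4) \<Rightarrow> (real^3 \<Rightarrow> real^4) \<Rightarrow> nat \<Rightarrow> real^3 \<Rightarrow> real" where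
  "curv_coeff X N k p =
     (-1)^k * (\<Sum>A | A \<subseteq> UNIV \<and> card A = k. \<Prod>i\<in>A. principal_curvatures X N p i)"

definition normal_sign :: "(real^3 \<Rightarrow> real^4) \<Rightarrow> real^3 \<Rightarrow> real" where
  "normal_sign N p = lorentz (N p) (N p)"

definition mean_curvature :: "(real^3 \<Rightarrow> real^4) \<Rightarrow> (real^3 \<Rightarrow> real^4) \<Rightarrow> nat \<Rightarrow> real^3 \<Rightarrow> real" where
  "mean_curvature X N k p = (- normal_sign N p)^k * curv_coeff X N k p / real (3 choose k)"

text \<open>The Cheng--Yau operator applied to the Gauss map:
  \<open>- \<epsilon> C\<^sub>1 (\<nabla>H\<^sub>2 + (3 H\<^sub>1 H\<^sub>2 - H\<^sub>3) N)\<close> with \<open>C\<^sub>1 = - 3 \<epsilon>\<close>.\<close>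

definition L1_gauss :: "(real^3 \<Rightarrow> real^4) \<Rightarrow> (real^3 \<Rightarrow> real^4) \<Rightarrow> real^3 \<Rightarrow> real^4" where
  "L1_gauss X N p =
     (let \<epsilon> = normal_sign N p; C1 = real (3 choose 2) * (- \<epsilon>); H = mean_curvature X N in
      (- \<epsilon> * C1) *\<^sub>R (hgrad X (H 2) p + (3 * H 1 p * H 2 p - H 3 p) *\<^sub>R N p))"

text \<open>Non-zero functions are functions that do not vanish identically.\<close>

definition generalized_L1_1type_gauss_map ::
    "(real^3) set \<Rightarrow> (real^3 \<Rightarrow> real^4) \<Rightarrow> (real^3 \<Rightarrow> real^4) \<Rightarrow> bool" where
  "generalized_L1_1type_gauss_map U X N \<longleftrightarrow>
     (\<exists>(m::real^3 \<Rightarrow> real) (n::real^3 \<Rightarrow> real) (C::real^4).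
        smooth_on U m \<and> smooth_on U n \<and> (\<exists>p\<in>U. m p \<noteq> 0) \<and> (\<exists>p\<in>U. n p \<noteq> 0) \<and> C \<noteq> 0 \<and>
        (\<forall>p\<in>U. L1_gauss X N p = m p *\<^sub>R N p + n p *\<^sub>R C))"


section \<open>Timelike Frenet curves and their tubes\<close>

definition timelike_frenet_curve ::
    "real set \<Rightarrow> (real \<Rightarrow> real^4) \<Rightarrow> (4 \<Rightarrow> real \<Rightarrow> real^4) \<Rightarrow>
     (real \<Rightarrow> real) \<Rightarrow> (real \<Rightarrow> real) \<Rightarrow> (real \<Rightarrow> real) \<Rightarrow> bool" where
  "timelike_frenet_curve I \<beta> F k1 k2 k3 \<longleftrightarrow>
     smooth_on I \<beta> \<and> (\<forall>i. smooth_on I (F i)) \<and>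
     smooth_on I k1 \<and> smooth_on I k2 \<and> smooth_on I k3 \<and>
     (\<forall>s\<in>I.
        (\<forall>i j. lorentz (F i s) (F j s) = (if i \<noteq> j then 0 else if i = 1 then -1 else 1)) \<and>
        (\<beta> has_vector_derivative F 1 s) (at s) \<and>
        (F 1 has_vector_derivative k1 s *\<^sub>R F 2 s) (at s) \<and>
        (F 2 has_vector_derivative k1 s *\<^sub>R F 1 s + k2 s *\<^sub>R F 3 s) (at s) \<and>
        (F 3 has_vector_derivative - k2 s *\<^sub>R F 2 s + k3 s *\<^sub>R F 4 s) (at s) \<and>
        (F 4 has_vector_derivative - k3 s *\<^sub>R F 3 s) (at s))"

text \<open>The parameter \<open>p\<close> is \<open>(s, t, w)\<close>.\<close>

definition tube_normal :: "(4 \<Rightarrow> real \<Rightarrow> real^4) \<Rightarrow> real^3 \<Rightarrow> real^4" where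
  "tube_normal F p = - ((cos (p$2) * cos (p$3)) *\<^sub>R F 2 (p$1)
     + (sin (p$2) * cos (p$3)) *\<^sub>R F 3 (p$1) + sin (p$3) *\<^sub>R F 4 (p$1))"

definition tube :: "(real \<Rightarrow> real^4) \<Rightarrow> (4 \<Rightarrow> real \<Rightarrow> real^4) \<Rightarrow> real \<Rightarrow> real^3 \<Rightarrow> real^4" where
  "tube \<beta> F r p = \<beta> (p$1) + r *\<^sub>R ((cos (p$2) * cos (p$3)) *\<^sub>R F 2 (p$1)
     + (sin (p$2) * cos (p$3)) *\<^sub>R F 3 (p$1) + sin (p$3) *\<^sub>R F 4 (p$1))"

end

theory Submission
  imports Defs
begin

text \<open>
  Write \<open>n = - N\<close> and \<open>f = 1 + r k\<^sub>1 cos t cos w\<close>. The second mean curvature is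
  \<open>H\<^sub>2 = (3 - 2/f) / (3 r\<^sup>2)\<close>, so \<open>\<nabla>H\<^sub>2\<close> is a multiple of \<open>\<nabla>f\<close>, which lies in the span of \<open>F\<^sub>1\<close>, \<open>F\<^sub>2\<close> and \<open>n\<close>.
  Hence \<open>L\<^sub>1 N = \<mu> N + \<nu> C\<close> forces \<open>C\<close> into that span wherever \<open>\<nu> \<noteq> 0\<close>.
  For fixed \<open>s\<close> the vector \<open>C\<close> does not depend on \<open>t\<close> and \<open>w\<close>; comparing \<open>F\<^sub>3\<close>- and \<open>F\<^sub>4\<close>-components
  shows that \<open>C\<close> lies in the span of \<open>F\<^sub>1\<close> and \<open>F\<^sub>2\<close>, and comparing the other two as trigonometric
  polynomials in \<open>t\<close> gives \<open>k\<^sub>1 \<langle>C, F\<^sub>1\<rangle> = 0\<close>. Where \<open>k\<^sub>1 \<noteq> 0\<close>, differentiating \<open>\<langle>C, F\<^sub>1\<rangle> = 0\<close> gives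
  \<open>\<langle>C, F\<^sub>2\<rangle> = 0\<close>; where \<open>k\<^sub>1\<close> vanishes on an interval, \<open>H\<^sub>2\<close> is constant and \<open>\<nu> C\<close> is parallel to \<open>n\<close>.
  In both cases \<open>C = 0\<close>.
\<close>

section \<open>Lorentz product, orthonormal frames and trigonometric polynomials\<close>

lemma lorentz_simps:
  "lorentz (x + y) z = lorentz x z + lorentz y z"
  "lorentz z (x + y) = lorentz z x + lorentz z y"
  "lorentz (x - y) z = lorentz x z - lorentz y z"
  "lorentz z (x - y) = lorentz z x - lorentz z y"
  "lorentz (- x) z = - lorentz x z"
  "lorentz z (- x) = - lorentz z x"
  "lorentz (a *\<^sub>R x) z = a * lorentz x z"
  "lorentz z (a *\<^sub>R x) = a * lorentz z x"
  by (simp_all add: lorentz_def algebra_simps)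

lemma bounded_linear_lorentz: "bounded_linear (lorentz C)"
  by (intro linear_conv_bounded_linear[THEN iffD1] linearI) (simp_all add: lorentz_simps)

text \<open>Pairing with the frame is a linear endomorphism \<open>T\<close> of \<real>^4 with an
  explicit right inverse, whose sign at \<open>e 1\<close> makes up for \<langle>e_1, e_1\<rangle> =
  -1. Being surjective, \<open>T\<close> is injective by dimension.\<close>

lemma lorentz_orthogonal_frame_eq_0:
  fixes e :: "4 \<Rightarrow> real^4"
  assumes frame: "\<And>i j. lorentz (e i) (e j) = (if i \<noteq> j then 0 else if i = 1 then -1 else 1)"
    and orth: "\<And>i. lorentz x (e i) = 0"
  shows "x = 0"
proof -
  define T :: "real^4 \<Rightarrow> real^4" where "T y = (\<chi> i. lorentz y (e i))" for y
  have lin: "linear T"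
    by (intro linearI) (simp_all add: T_def vec_eq_iff lorentz_simps)
  have "T (- (y$1) *\<^sub>R e 1 + y$2 *\<^sub>R e 2 + y$3 *\<^sub>R e 3 + y$4 *\<^sub>R e 4) = y" for y
    by (simp add: T_def vec_eq_iff forall_4 lorentz_simps frame)
  then have "surj T" by (rule surjI)
  then have "inj T" using linear_surjective_imp_injective[OF lin] by simp
  moreover have "T x = T 0" using orth by (simp add: T_def vec_eq_iff lorentz_def)
  ultimately show ?thesis by (simp add: inj_eq)
qed

text \<open>Linear independence of 1, cos and sin on an interval: differentiating the relation once
  and twice gives two equations at \<open>x0\<close> whose squares add up to a^2 + b^2.\<close>

lemma trig_affine_eq_0:
  fixes a b d x0 e :: real
  assumes "e > 0" and z: "\<And>x. \<bar>x - x0\<bar> < e \<Longrightarrow> a * cos x + b * sin x + d = 0"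
  shows "a = 0" "b = 0" "d = 0"
proof -
  define S where "S = {x. \<bar>x - x0\<bar> < e}"
  have S: "open S" "x0 \<in> S"
    using \<open>e > 0\<close> by (auto simp: S_def intro!: open_Collect_less continuous_intros)
  have D0: "f' = 0" if "\<And>x. x \<in> S \<Longrightarrow> f x = 0" "(f has_real_derivative f') (at x)" "x \<in> S" for f f' x
  proof -
    have "((\<lambda>_. 0) has_real_derivative f') (at x)"
      by (rule has_field_derivative_transform_within_open[OF that(2) S(1) that(3)]) (simp add: that(1))
    then show ?thesis by (rule DERIV_unique) simp
  qed
  have 1: "- a * sin x + b * cos x = 0" if "x \<in> S" for x
    by (rule D0[OF _ _ that, of "\<lambda>x. a * cos x + b * sin x + d"])
      (auto simp: z S_def intro!: derivative_eq_intros)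
  have 2: "- a * cos x - b * sin x = 0" if "x \<in> S" for x
    by (rule D0[OF _ _ that, of "\<lambda>x. - a * sin x + b * cos x"])
      (use 1 in \<open>auto intro!: derivative_eq_intros\<close>)
  note e = 1[OF S(2)] 2[OF S(2)]
  have "(- a * sin x0 + b * cos x0)\<^sup>2 + (- a * cos x0 - b * sin x0)\<^sup>2
      = (a\<^sup>2 + b\<^sup>2) * ((sin x0)\<^sup>2 + (cos x0)\<^sup>2)"
    by algebra
  then have "a\<^sup>2 + b\<^sup>2 = 0" using e by simp
  then show "a = 0" "b = 0" by (simp_all add: sum_power2_eq_zero_iff)
  then show "d = 0" using z[of x0] \<open>e > 0\<close> by simp
qed

section \<open>Second symmetric function of the principal curvatures\<close>

lemma prod_3: "prod g (UNIV::3 set) = g 1 * g 2 * g 3"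
  unfolding UNIV_3 by (simp add: ac_simps)

text \<open>For a monic cubic p with linear coefficient e, p(1) - p(-1) = 2 + 2e, so two values
  determine e.\<close>

lemma monic_cubic_linear_coeff_eq:
  fixes a b c a' b' c' :: real
  assumes "\<And>x. (x - a) * (x - b) * (x - c) = (x - a') * (x - b') * (x - c')"
  shows "a*b + a*c + b*c = a'*b' + a'*c' + b'*c'"
proof -
  have "2 * (u * v + u * w + v * w)
      = (1 - u) * (1 - v) * (1 - w) - (- 1 - u) * (- 1 - v) * (- 1 - w) - 2" for u v w :: real
    by algebra
  then have "2 * (a * b + a * c + b * c) = 2 * (a' * b' + a' * c' + b' * c')"
    by (simp only: assms)
  then show ?thesis by simp
qed

text \<open>The principal curvatures come from a choice operator. The given factorization shows that
  a valid choice exists, and any valid choice has the same characteristic cubic, hence the same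
  second symmetric function.\<close>

lemma curv_coeff_2_eq:
  assumes det: "\<And>x::real. det (mat x - matrix (shape_operator X N p)) = (x - a) * (x - b) * (x - c)"
  shows "curv_coeff X N 2 p = a*b + a*c + b*c"
proof -
  define \<kappa> where "\<kappa> = principal_curvatures X N p"
  have "(\<Prod>i\<in>UNIV. x - (if i = (1::3) then a else if i = 2 then b else c)) = (x - a) * (x - b) * (x - c)"
    for x by (simp add: prod_3)
  then have "\<forall>x. det (mat x - matrix (shape_operator X N p))
      = (\<Prod>i\<in>UNIV. x - (if i = (1::3) then a else if i = 2 then b else c))"
    by (simp only: det simp_thms)
  then have "\<exists>\<kappa>::3 \<Rightarrow> real. \<forall>x. det (mat x - matrix (shape_operator X N p)) = (\<Prod>i\<in>UNIV. x - \<kappa> i)"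
    by (rule exI[of _ "\<lambda>i. if i = 1 then a else if i = 2 then b else c"])
  then have "\<forall>x. det (mat x - matrix (shape_operator X N p)) = (\<Prod>i\<in>UNIV. x - \<kappa> i)"
    unfolding \<kappa>_def principal_curvatures_def by (rule someI_ex)
  then have "(\<Prod>i\<in>UNIV. x - \<kappa> i) = (x - a) * (x - b) * (x - c)" for x
    by (simp only: det)
  then have eq: "(x - \<kappa> 1) * (x - \<kappa> 2) * (x - \<kappa> 3) = (x - a) * (x - b) * (x - c)" for x
    by (simp only: prod_3)
  have 2: "{A::3 set. A \<subseteq> UNIV \<and> card A = 2} = {{1,2}, {1,3}, {2,3}}"
  proof -
    have "A \<in> {{1,2}, {1,3}, {2,3}}" if A: "card A = 2" for A :: "3 set"
    proof -
      obtain x y where "A = {x, y}" "x \<noteq> y" using A by (auto simp: card_2_iff)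
      then show ?thesis using exhaust_3[of x] exhaust_3[of y] by (auto simp: doubleton_eq_iff)
    qed
    then show ?thesis by auto
  qed
  have ne: "{1::3,2} \<noteq> {1,3}" "{1::3,2} \<noteq> {2,3}" "{1::3,3} \<noteq> {2,3}"
    by (auto simp: doubleton_eq_iff)
  have "curv_coeff X N 2 p = \<kappa> 1 * \<kappa> 2 + \<kappa> 1 * \<kappa> 3 + \<kappa> 2 * \<kappa> 3"
    unfolding curv_coeff_def 2 \<kappa>_def[symmetric] by (simp add: ne add.assoc)
  also have "\<dots> = a*b + a*c + b*c"
    by (rule monic_cubic_linear_coeff_eq[OF eq])
  finally show "curv_coeff X N 2 p = a*b + a*c + b*c" .
qed

section \<open>Differentiability and coordinate boxes in the parameter space\<close>

lemma has_derivative_vec_nth: "((\<lambda>p::real^'n. p$i) has_derivative (\<lambda>u. u$i)) G"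
  by (intro bounded_linear.has_derivative[OF bounded_linear_vec_nth] has_derivative_ident)

lemma differentiable_if_smooth_on: "smooth_on S f \<Longrightarrow> x \<in> S \<Longrightarrow> f differentiable (at x)"
  unfolding smooth_on_def by (metis Ck_on.simps(2))

lemma continuous_on_if_smooth_on: "smooth_on S f \<Longrightarrow> continuous_on S f"
  unfolding smooth_on_def by (metis Ck_on.simps(1))

text \<open>Provides a box in which \<open>s\<close>, \<open>t\<close> and \<open>w\<close> vary
  independently; the bound d/3 on each coordinate suffices by comparison with the l1 norm.\<close>

lemma vector_3_in_open:
  fixes V :: "(real^3) set"
  assumes "open V" "p \<in> V"
  obtains e where "e > 0"
    and "\<And>s t w. \<bar>s - p$1\<bar> < e \<Longrightarrow> \<bar>t - p$2\<bar> < e \<Longrightarrow> \<bar>w - p$3\<bar> < e \<Longrightarrow> vector [s, t, w] \<in> V"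
proof -
  obtain d where d: "d > 0" "ball p d \<subseteq> V" using assms openE by blast
  show thesis
  proof (rule that[of "d/3"])
    fix s t w :: real
    assume h: "\<bar>s - p$1\<bar> < d/3" "\<bar>t - p$2\<bar> < d/3" "\<bar>w - p$3\<bar> < d/3"
    have "norm (vector [s,t,w] - p) \<le> (\<Sum>i\<in>UNIV. \<bar>(vector [s,t,w] - p) $ i\<bar>)"
      by (rule norm_le_l1_cart)
    also have "\<dots> < d" using h by (simp add: sum_3)
    finally show "vector [s,t,w] \<in> V" using d by (auto simp: dist_norm norm_minus_commute)
  qed (use d in simp)
qed

section \<open>The tube and an orthonormal basis of its tangent spaces\<close>

locale timelike_tube =
  fixes I :: "real set" and \<beta> :: "real \<Rightarrow> real^4" and F :: "4 \<Rightarrow> real \<Rightarrow> real^4"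
    and k1 k2 k3 :: "real \<Rightarrow> real" and r :: real and U :: "(real^3) set"
  assumes frenet: "timelike_frenet_curve I \<beta> F k1 k2 k3"
    and r_pos: "r > 0"
    and openU: "open U" and proj: "p \<in> U \<Longrightarrow> p$1 \<in> I"
    and immersion: "immersion_on U (tube \<beta> F r)"
begin

lemma frame: "s \<in> I \<Longrightarrow> lorentz (F i s) (F j s) = (if i \<noteq> j then 0 else if i = 1 then -1 else 1)"
  using frenet by (simp add: timelike_frenet_curve_def)

lemma frenet_equations:
  assumes "s \<in> I"
  shows "(\<beta> has_vector_derivative F 1 s) (at s)"
    "(F 1 has_vector_derivative k1 s *\<^sub>R F 2 s) (at s)"
    "(F 2 has_vector_derivative k1 s *\<^sub>R F 1 s + k2 s *\<^sub>R F 3 s) (at s)"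
    "(F 3 has_vector_derivative - k2 s *\<^sub>R F 2 s + k3 s *\<^sub>R F 4 s) (at s)"
    "(F 4 has_vector_derivative - k3 s *\<^sub>R F 3 s) (at s)"
  using frenet assms by (auto simp: timelike_frenet_curve_def)

lemma k1_derivative: "s \<in> I \<Longrightarrow> (k1 has_real_derivative deriv k1 s) (at s)"
  using frenet by (auto simp: timelike_frenet_curve_def DERIV_deriv_iff_real_differentiable
      intro!: differentiable_if_smooth_on)

text \<open>The \<open>F 1\<close>-coefficient of the s-derivative of the tube.\<close>

definition f :: "real^3 \<Rightarrow> real" where
  "f p = 1 + r * k1 (p$1) * cos (p$2) * cos (p$3)"

text \<open>Together with \<open>F 1\<close> the vectors \<open>E\<^sub>t\<close> and \<open>E\<^sub>w\<close> form an orthonormal basis of the tangent space.\<close>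

definition E\<^sub>t :: "real^3 \<Rightarrow> real^4" where
  "E\<^sub>t p = - sin (p$2) *\<^sub>R F 2 (p$1) + cos (p$2) *\<^sub>R F 3 (p$1)"

definition E\<^sub>w :: "real^3 \<Rightarrow> real^4" where
  "E\<^sub>w p = - (cos (p$2) * sin (p$3)) *\<^sub>R F 2 (p$1) - (sin (p$2) * sin (p$3)) *\<^sub>R F 3 (p$1)
     + cos (p$3) *\<^sub>R F 4 (p$1)"

definition tangent :: "real^3 \<Rightarrow> real \<Rightarrow> real \<Rightarrow> real \<Rightarrow> real^4" where
  "tangent p a b c = a *\<^sub>R F 1 (p$1) + b *\<^sub>R E\<^sub>t p + c *\<^sub>R E\<^sub>w p"

text \<open>The components of the \<open>s\<close>-derivative of the unit normal \<open>- tube_normal F\<close> along \<open>E\<^sub>t\<close> and \<open>E\<^sub>w\<close>.\<close>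

definition A\<^sub>t :: "real^3 \<Rightarrow> real" where
  "A\<^sub>t p = k2 (p$1) * cos (p$3) - k3 (p$1) * cos (p$2) * sin (p$3)"

definition A\<^sub>w :: "real^3 \<Rightarrow> real" where
  "A\<^sub>w p = k3 (p$1) * sin (p$2)"

lemma scaleR_tangent: "d *\<^sub>R tangent p a b c = tangent p (d * a) (d * b) (d * c)"
  by (simp add: tangent_def scaleR_add_right)

lemma lorentz_tangent:
  assumes "p$1 \<in> I"
  shows "lorentz (tangent p a b c) (tangent p a' b' c') = - (a * a') + b * b' + c * c'"
proof -
  \<comment> \<open>The sums of squares are kept unevaluated, which makes this a polynomial identity
    in sines and cosines; the Pythagorean identity enters only afterwards.\<close>
  have "lorentz (tangent p a b c) (tangent p a' b' c') =
    - (a * a') + b * b' * ((sin (p$2))\<^sup>2 + (cos (p$2))\<^sup>2)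
      + c * c' * (((sin (p$2))\<^sup>2 + (cos (p$2))\<^sup>2) * (sin (p$3))\<^sup>2 + (cos (p$3))\<^sup>2)"
    by (simp add: tangent_def E\<^sub>t_def E\<^sub>w_def lorentz_simps frame[OF assms]
        del: sin_cos_squared_add sin_cos_squared_add2 sin_cos_squared_add3)
      (simp add: algebra_simps power2_eq_square del: sin_cos_squared_add3)
  then show ?thesis by simp
qed

lemma tangent_eq_iff:
  assumes "p$1 \<in> I"
  shows "tangent p a b c = tangent p a' b' c' \<longleftrightarrow> a = a' \<and> b = b' \<and> c = c'"
proof
  assume eq: "tangent p a b c = tangent p a' b' c'"
  show "a = a' \<and> b = b' \<and> c = c'"
    using arg_cong[OF eq, of "\<lambda>v. lorentz v (tangent p 1 0 0)"]
      arg_cong[OF eq, of "\<lambda>v. lorentz v (tangent p 0 1 0)"]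
      arg_cong[OF eq, of "\<lambda>v. lorentz v (tangent p 0 0 1)"]
    by (simp add: lorentz_tangent[OF assms])
qed simp

lemma normal_sign_tube:
  assumes "p$1 \<in> I"
  shows "normal_sign (tube_normal F) p = 1"
proof -
  have "normal_sign (tube_normal F) p
      = ((sin (p$2))\<^sup>2 + (cos (p$2))\<^sup>2) * (cos (p$3))\<^sup>2 + (sin (p$3))\<^sup>2"
    by (simp add: normal_sign_def tube_normal_def lorentz_simps frame[OF assms]
        del: sin_cos_squared_add sin_cos_squared_add2 sin_cos_squared_add3)
      (simp add: algebra_simps power2_eq_square del: sin_cos_squared_add3)
  then show ?thesis by simp
qed

section \<open>Differentials of the Gauss map and of the tube\<close>

lemma tube_normal_derivative:
  assumes "p$1 \<in> I"
  shows "(tube_normal F has_derivative (\<lambda>u. - tangent p (k1 (p$1) * cos (p$2) * cos (p$3) * u$1)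
            (A\<^sub>t p * u$1 + cos (p$3) * u$2) (A\<^sub>w p * u$1 + u$3))) (at p)"
proof -
  have comp: "((\<lambda>p. F i (p$1)) has_derivative (\<lambda>u. u$1 *\<^sub>R G)) (at p)"
    if "(F i has_vector_derivative G) (at (p$1))" for i G
    by (rule has_derivative_compose[of "\<lambda>p. p$1" "\<lambda>u. u$1" p UNIV "F i" "\<lambda>h. h *\<^sub>R G"])
      (use that in \<open>auto simp: has_vector_derivative_def has_derivative_vec_nth\<close>)
  note d = frenet_equations(3-5)[OF assms, THEN comp]
  have id: "(sin (p$2))\<^sup>2 + (cos (p$2))\<^sup>2 = 1" by simp
  \<comment> \<open>\<open>c2\<close> and \<open>c3\<close> convert the s-derivative from the basis
    \<open>E\<^sub>t\<close>, \<open>E\<^sub>w\<close> back to the \<open>F 2\<close>- and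
    \<open>F 3\<close>-coefficients given by the Frenet equations.\<close>
  have c2: "- A\<^sub>t p * sin (p$2) - A\<^sub>w p * cos (p$2) * sin (p$3) = - k2 (p$1) * sin (p$2) * cos (p$3)"
    unfolding A\<^sub>t_def A\<^sub>w_def by algebra
  have c3: "A\<^sub>t p * cos (p$2) - A\<^sub>w p * sin (p$2) * sin (p$3)
      = k2 (p$1) * cos (p$2) * cos (p$3) - k3 (p$1) * sin (p$3)"
    using id unfolding A\<^sub>t_def A\<^sub>w_def by algebra
  have "tangent p (k1 (p$1) * cos (p$2) * cos (p$3) * u$1)
      (A\<^sub>t p * u$1 + cos (p$3) * u$2) (A\<^sub>w p * u$1 + u$3)
    = (k1 (p$1) * cos (p$2) * cos (p$3) * u$1) *\<^sub>R F 1 (p$1)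
      + (u$1 * (- A\<^sub>t p * sin (p$2) - A\<^sub>w p * cos (p$2) * sin (p$3))
        - sin (p$2) * cos (p$3) * u$2 - cos (p$2) * sin (p$3) * u$3) *\<^sub>R F 2 (p$1)
      + (u$1 * (A\<^sub>t p * cos (p$2) - A\<^sub>w p * sin (p$2) * sin (p$3))
        + cos (p$2) * cos (p$3) * u$2 - sin (p$2) * sin (p$3) * u$3) *\<^sub>R F 3 (p$1)
      + (A\<^sub>w p * cos (p$3) * u$1 + cos (p$3) * u$3) *\<^sub>R F 4 (p$1)" for u :: "real^3"
    by (simp add: tangent_def E\<^sub>t_def E\<^sub>w_def algebra_simps)
  note tangent = this[unfolded c2 c3]
  show ?thesis
    unfolding tube_normal_def[abs_def] tangent
    by (rule has_derivative_eq_rhs, (rule derivative_eq_intros d has_derivative_vec_nth refl)+)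
      (simp add: A\<^sub>w_def fun_eq_iff algebra_simps)
qed

text \<open>The tube is \<beta> - r N, so the differential is that of \<beta> minus r dN; the
  summand \<open>F 1\<close> from \<beta> completes the first coefficient to
  \<open>f p\<close>.\<close>

lemma tube_derivative:
  assumes "p$1 \<in> I"
  shows "(tube \<beta> F r has_derivative (\<lambda>u. tangent p (f p * u$1)
            (r * (A\<^sub>t p * u$1 + cos (p$3) * u$2)) (r * (A\<^sub>w p * u$1 + u$3)))) (at p)"
proof -
  have tube: "tube \<beta> F r = (\<lambda>p. \<beta> (p$1) - r *\<^sub>R tube_normal F p)"
    by (simp add: fun_eq_iff tube_def tube_normal_def algebra_simps)
  have "((\<lambda>p. \<beta> (p$1)) has_derivative (\<lambda>u. u$1 *\<^sub>R F 1 (p$1))) (at p)"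
    by (rule has_derivative_compose[of "\<lambda>p. p$1" "\<lambda>u. u$1" p UNIV \<beta> "\<lambda>h. h *\<^sub>R F 1 (p$1)"])
      (use frenet_equations(1)[OF assms] in
        \<open>auto simp: has_vector_derivative_def has_derivative_vec_nth\<close>)
  note * = has_derivative_diff[OF this
      has_derivative_scaleR_right[OF tube_normal_derivative[OF assms], of r]]
  show ?thesis unfolding tube
    by (rule has_derivative_eq_rhs[OF *]) (simp add: fun_eq_iff tangent_def f_def algebra_simps)
qed

definition dT :: "real^3 \<Rightarrow> real^3 \<Rightarrow> real^4" where
  "dT p = frechet_derivative (tube \<beta> F r) (at p)"

lemma dT_eq:
  assumes "p \<in> U"
  shows "dT p u = tangent p (f p * u$1)
            (r * (A\<^sub>t p * u$1 + cos (p$3) * u$2)) (r * (A\<^sub>w p * u$1 + u$3))"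
  unfolding dT_def frechet_derivative_at[OF tube_derivative[OF proj[OF assms]], symmetric] ..

lemma inj_dT: "p \<in> U \<Longrightarrow> inj (dT p)"
  using immersion by (simp add: immersion_on_def dT_def)

lemma cos_nonzero:
  assumes "p \<in> U"
  shows "cos (p$3) \<noteq> 0"
proof
  assume "cos (p$3) = 0"
  then have "dT p (vector [0,1,0]) = dT p 0" using assms by (simp add: dT_eq)
  then have "vector [0,1,0] = (0::real^3)" by (rule injD[OF inj_dT[OF assms]])
  then show False by (simp add: vec_eq_iff forall_3)
qed

lemma f_nonzero:
  assumes "p \<in> U"
  shows "f p \<noteq> 0"
proof
  assume "f p = 0"
  \<comment> \<open>The second and third entries cancel the \<open>E\<^sub>t\<close>- and
    \<open>E\<^sub>w\<close>-components produced by the first; what remains is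
    \<open>f p * cos (p$3)\<close> along \<open>F 1\<close>.\<close>
  then have "dT p (vector [cos (p$3), - A\<^sub>t p, - A\<^sub>w p * cos (p$3)]) = dT p 0"
    using assms by (simp add: dT_eq)
  then have "vector [cos (p$3), - A\<^sub>t p, - A\<^sub>w p * cos (p$3)] = (0::real^3)"
    by (rule injD[OF inj_dT[OF assms]])
  then show False using cos_nonzero[OF assms] by (simp add: vec_eq_iff forall_3)
qed

text \<open>Back substitution in the triangular system
  \<open>dT p u = tangent p a b c\<close>.\<close>

definition dT_inv :: "real^3 \<Rightarrow> real \<Rightarrow> real \<Rightarrow> real \<Rightarrow> real^3" where
  "dT_inv p a b c = vector [a / f p, (b / r - A\<^sub>t p * a / f p) / cos (p$3), c / r - A\<^sub>w p * a / f p]"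

lemma dT_dT_inv: "p \<in> U \<Longrightarrow> dT p (dT_inv p a b c) = tangent p a b c"
  using r_pos by (simp add: dT_eq dT_inv_def cos_nonzero f_nonzero)

section \<open>Shape operator and second mean curvature\<close>

lemma shape_operator_tube:
  assumes "p \<in> U"
  shows "shape_operator (tube \<beta> F r) (tube_normal F) p v =
    dT_inv p (k1 (p$1) * cos (p$2) * cos (p$3) * v$1)
      (A\<^sub>t p * v$1 + cos (p$3) * v$2) (A\<^sub>w p * v$1 + v$3)"
  unfolding shape_operator_def dT_def[symmetric]
    frechet_derivative_at[OF tube_normal_derivative[OF proj[OF assms]], symmetric]
proof (rule the_equality)
  show "w = dT_inv p (k1 (p$1) * cos (p$2) * cos (p$3) * v$1)
      (A\<^sub>t p * v$1 + cos (p$3) * v$2) (A\<^sub>w p * v$1 + v$3)"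
    if "dT p w = - (- tangent p (k1 (p$1) * cos (p$2) * cos (p$3) * v$1)
      (A\<^sub>t p * v$1 + cos (p$3) * v$2) (A\<^sub>w p * v$1 + v$3))" for w
    using that dT_dT_inv[OF assms] injD[OF inj_dT[OF assms]] by simp
qed (simp add: dT_dT_inv[OF assms])

lemma mean_curvature_2_tube:
  assumes "p \<in> U"
  shows "mean_curvature (tube \<beta> F r) (tube_normal F) 2 p = (3 - 2 / f p) / (3 * r\<^sup>2)"
proof -
  define \<kappa> where "\<kappa> = k1 (p$1) * cos (p$2) * cos (p$3) / f p"
  have nz: "cos (p$3) \<noteq> 0" "f p \<noteq> 0" "r \<noteq> 0"
    using assms cos_nonzero f_nonzero r_pos by auto
  \<comment> \<open>In the coordinates (s, t, w) the shape operator is lower triangular with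
    diagonal \<kappa>, 1/r, 1/r.\<close>
  have "det (mat x - matrix (shape_operator (tube \<beta> F r) (tube_normal F) p))
      = (x - \<kappa>) * (x - 1/r) * (x - 1/r)" for x :: real
    using nz by (simp add: det_3 matrix_def mat_def shape_operator_tube[OF assms] dT_inv_def axis_def \<kappa>_def)
  then have "curv_coeff (tube \<beta> F r) (tube_normal F) 2 p = \<kappa>*(1/r) + \<kappa>*(1/r) + (1/r)*(1/r)"
    by (rule curv_coeff_2_eq)
  also have "\<kappa> = (1 - 1 / f p) / r"
    using nz by (simp add: \<kappa>_def divide_simps) (simp add: f_def)
  also have "(1 - 1 / f p) / r * (1/r) + (1 - 1 / f p) / r * (1/r) + (1/r)*(1/r) = (3 - 2 / f p) / r\<^sup>2"
    using nz by (simp add: divide_simps power2_eq_square)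
  finally show ?thesis
    by (simp add: mean_curvature_def normal_sign_tube[OF proj[OF assms]] choose_two)
qed

section \<open>Gradient of the second mean curvature\<close>

definition df :: "real^3 \<Rightarrow> real^3 \<Rightarrow> real" where
  "df p u = r * (deriv k1 (p$1) * cos (p$2) * cos (p$3) * u$1
     - k1 (p$1) * sin (p$2) * cos (p$3) * u$2 - k1 (p$1) * cos (p$2) * sin (p$3) * u$3)"

lemma f_derivative:
  assumes "p$1 \<in> I"
  shows "(f has_derivative df p) (at p)"
proof -
  have "((\<lambda>p. k1 (p$1)) has_derivative (\<lambda>u. deriv k1 (p$1) * u$1)) (at p)"
    by (rule has_derivative_compose[of "\<lambda>p. p$1" "\<lambda>u. u$1" p UNIV k1 "\<lambda>h. deriv k1 (p$1) * h"])
      (use k1_derivative[OF assms] in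
        \<open>auto simp: has_field_derivative_def has_derivative_vec_nth\<close>)
  note d = this
  show ?thesis
    unfolding f_def[abs_def] df_def[abs_def]
    by (rule has_derivative_eq_rhs, (rule derivative_eq_intros d has_derivative_vec_nth refl)+)
      (simp add: fun_eq_iff algebra_simps)
qed

lemma frechet_derivative_mean_curvature_2:
  assumes "p \<in> U"
  shows "frechet_derivative (mean_curvature (tube \<beta> F r) (tube_normal F) 2) (at p)
    = (\<lambda>u. 2 / (3 * r\<^sup>2 * (f p)\<^sup>2) * df p u)"
proof -
  have nz: "f p \<noteq> 0" "r \<noteq> 0" "3 * r\<^sup>2 \<noteq> 0" using f_nonzero[OF assms] r_pos by auto
  have "((\<lambda>p. (3 - 2 / f p) / (3 * r\<^sup>2)) has_derivative (\<lambda>u. 2 / (3 * r\<^sup>2 * (f p)\<^sup>2) * df p u)) (at p)"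
    by (rule has_derivative_eq_rhs, (rule derivative_eq_intros f_derivative[OF proj[OF assms]] refl nz)+)
      (use nz in \<open>simp add: fun_eq_iff field_simps power2_eq_square\<close>)
  then have "(mean_curvature (tube \<beta> F r) (tube_normal F) 2 has_derivative
      (\<lambda>u. 2 / (3 * r\<^sup>2 * (f p)\<^sup>2) * df p u)) (at p)"
    by (rule has_derivative_transform_within_open[OF _ openU assms])
      (simp add: mean_curvature_2_tube)
  then show ?thesis by (rule frechet_derivative_at[symmetric])
qed

text \<open>The coordinates are the values of dH_2 on the \<open>dT_inv\<close>-preimages of the
  orthonormal basis, with a sign change for the timelike \<open>F 1\<close>; the \<open>k3\<close>
  terms cancel. The factor 3 is the one in front of the gradient in \<open>L1_gauss\<close> for
  \<epsilon> = 1.\<close>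

lemma hgrad_mean_curvature_2:
  assumes "p \<in> U"
  shows "3 *\<^sub>R hgrad (tube \<beta> F r) (mean_curvature (tube \<beta> F r) (tube_normal F) 2) p = tangent p
    (- 2 * cos (p$3) * (deriv k1 (p$1) * cos (p$2) + k1 (p$1) * k2 (p$1) * sin (p$2)) / (r * f p ^ 3))
    (- 2 * k1 (p$1) * sin (p$2) / (r\<^sup>2 * (f p)\<^sup>2))
    (- 2 * k1 (p$1) * cos (p$2) * sin (p$3) / (r\<^sup>2 * (f p)\<^sup>2))"
    (is "_ = tangent p ?a ?b ?c")
proof -
  note pI = proj[OF assms]
  have nz: "cos (p$3) \<noteq> 0" "f p \<noteq> 0" "r \<noteq> 0"
    using assms cos_nonzero f_nonzero r_pos by auto
  let ?v = "dT_inv p (?a/3) (?b/3) (?c/3)"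
  have sol: "lorentz (dT p ?v) (dT p u) = 2 / (3 * r\<^sup>2 * (f p)\<^sup>2) * df p u" for u
    unfolding dT_dT_inv[OF assms] unfolding dT_eq[OF assms] lorentz_tangent[OF pI] df_def A\<^sub>t_def A\<^sub>w_def
    using nz by (simp add: field_simps power2_eq_square power3_eq_cube)
  have "(THE v. \<forall>u. lorentz (dT p v) (dT p u) = 2 / (3 * r\<^sup>2 * (f p)\<^sup>2) * df p u) = ?v"
  proof (rule the_equality)
    fix v assume v: "\<forall>u. lorentz (dT p v) (dT p u) = 2 / (3 * r\<^sup>2 * (f p)\<^sup>2) * df p u"
    \<comment> \<open>Every tangent vector is some \<open>dT p u\<close>, so both candidates may be
      tested against the three basis vectors.\<close>
    have "lorentz (dT p v) (tangent p a b c) = lorentz (dT p ?v) (tangent p a b c)" for a b c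
      using v sol dT_dT_inv[OF assms] by metis
    from this[of 1 0 0] this[of 0 1 0] this[of 0 0 1]
    have "dT p v = dT p ?v"
      unfolding dT_dT_inv[OF assms] unfolding dT_eq[OF assms]
      by (simp add: lorentz_tangent[OF pI] tangent_eq_iff[OF pI])
    then show "v = ?v" using inj_dT[OF assms] by (simp add: inj_eq)
  qed (use sol in blast)
  moreover have three: "3 * (x / 3) = x" for x :: real by simp
  ultimately show ?thesis
    unfolding hgrad_def frechet_derivative_mean_curvature_2[OF assms] dT_def[symmetric]
    by (simp only: dT_dT_inv[OF assms] scaleR_tangent three)
qed

section \<open>The 1-type equation in the Frenet frame\<close>

lemma gauss_map_equations:
  assumes p: "p \<in> U" and C: "L1_gauss (tube \<beta> F r) (tube_normal F) p = m *\<^sub>R tube_normal F p + n *\<^sub>R C"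
  obtains Q where
    "n * lorentz C (F 1 (p$1)) = 2 * cos (p$3) *
       (deriv k1 (p$1) * cos (p$2) + k1 (p$1) * k2 (p$1) * sin (p$2)) / (r * f p ^ 3)"
    "n * lorentz C (F 2 (p$1)) = 2 * k1 (p$1) / (r\<^sup>2 * (f p)\<^sup>2) + Q * cos (p$2) * cos (p$3)"
    "n * lorentz C (F 3 (p$1)) = Q * sin (p$2) * cos (p$3)"
    "n * lorentz C (F 4 (p$1)) = Q * sin (p$3)"
proof -
  note fr = frame[OF proj[OF p]]
  have shift: "m *\<^sub>R N + y = T + q *\<^sub>R N \<Longrightarrow> y = T + (q - m) *\<^sub>R N" for N y T :: "real^4" and q
    by (simp add: algebra_simps)
  \<comment> \<open>The whole normal part of \<open>L1_gauss\<close>, which is later absorbed into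
    \<open>Q\<close>.\<close>
  define q where "q = 3 * (3 * mean_curvature (tube \<beta> F r) (tube_normal F) 1 p
    * mean_curvature (tube \<beta> F r) (tube_normal F) 2 p - mean_curvature (tube \<beta> F r) (tube_normal F) 3 p)"
  define G where "G = 2 * cos (p$3) *
    (deriv k1 (p$1) * cos (p$2) + k1 (p$1) * k2 (p$1) * sin (p$2)) / (r * f p ^ 3)"
  define P where "P = 2 * k1 (p$1) / (r\<^sup>2 * (f p)\<^sup>2)"
  have "L1_gauss (tube \<beta> F r) (tube_normal F) p =
      3 *\<^sub>R hgrad (tube \<beta> F r) (mean_curvature (tube \<beta> F r) (tube_normal F) 2) p + q *\<^sub>R tube_normal F p"
    unfolding L1_gauss_def Let_def normal_sign_tube[OF proj[OF p]] q_def
    by (simp add: choose_two scaleR_add_right)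
  also have "3 *\<^sub>R hgrad (tube \<beta> F r) (mean_curvature (tube \<beta> F r) (tube_normal F) 2) p
      = tangent p (- G) (- P * sin (p$2)) (- P * cos (p$2) * sin (p$3))"
    unfolding hgrad_mean_curvature_2[OF p] by (simp add: G_def P_def)
  finally have "n *\<^sub>R C = tangent p (- G) (- P * sin (p$2)) (- P * cos (p$2) * sin (p$3))
      + (q - m) *\<^sub>R tube_normal F p"
    unfolding C by (rule shift)
  then have eq: "n * lorentz C x = lorentz (tangent p (- G) (- P * sin (p$2)) (- P * cos (p$2) * sin (p$3))
      + (q - m) *\<^sub>R tube_normal F p) x" for x
    by (simp only: lorentz_simps(7)[symmetric])
  have id: "(sin (p$2))\<^sup>2 + (cos (p$2))\<^sup>2 = 1" "(sin (p$3))\<^sup>2 + (cos (p$3))\<^sup>2 = 1" by simp_all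
  show thesis
  \<comment> \<open>The \<open>E\<^sub>t\<close>- and \<open>E\<^sub>w\<close>-part of the gradient
    is the tangential projection of \<open>P *\<^sub>R F 2 (p$1)\<close>. Replacing it by this
    vector itself costs P cos t cos w along -N, to which m - q is added from the normal
    terms.\<close>
  proof (rule that[of "m - q - P * cos (p$2) * cos (p$3)"], unfold G_def[symmetric] P_def[symmetric])
    show "n * lorentz C (F 1 (p$1)) = G"
      unfolding eq tangent_def E\<^sub>t_def E\<^sub>w_def tube_normal_def by (simp add: lorentz_simps fr)
    show "n * lorentz C (F 2 (p$1)) = P + (m - q - P * cos (p$2) * cos (p$3)) * cos (p$2) * cos (p$3)"
      using id unfolding eq tangent_def E\<^sub>t_def E\<^sub>w_def tube_normal_def
      by (simp add: lorentz_simps fr del: sin_cos_squared_add) algebra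
    show "n * lorentz C (F 3 (p$1)) = (m - q - P * cos (p$2) * cos (p$3)) * sin (p$2) * cos (p$3)"
      using id unfolding eq tangent_def E\<^sub>t_def E\<^sub>w_def tube_normal_def
      by (simp add: lorentz_simps fr del: sin_cos_squared_add) algebra
    show "n * lorentz C (F 4 (p$1)) = (m - q - P * cos (p$2) * cos (p$3)) * sin (p$3)"
      unfolding eq tangent_def E\<^sub>t_def E\<^sub>w_def tube_normal_def
      by (simp add: lorentz_simps fr) algebra
  qed
qed

section \<open>Contradiction from the components of the constant vector\<close>

lemma not_generalized_L1_1type:
  "\<not> generalized_L1_1type_gauss_map U (tube \<beta> F r) (tube_normal F)"
proof
  assume "generalized_L1_1type_gauss_map U (tube \<beta> F r) (tube_normal F)"
  then obtain m n :: "real^3 \<Rightarrow> real" and C p0 where n: "smooth_on U n" "p0 \<in> U" "n p0 \<noteq> 0"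
    and C: "C \<noteq> 0"
    and L: "\<And>p. p \<in> U \<Longrightarrow> L1_gauss (tube \<beta> F r) (tube_normal F) p = m p *\<^sub>R tube_normal F p + n p *\<^sub>R C"
    unfolding generalized_L1_1type_gauss_map_def by blast
  define V where "V = {p \<in> U. n p \<noteq> 0}"
  have "V = U \<inter> n -` (- {0})" by (auto simp: V_def)
  then have "open V"
    using continuous_open_preimage[OF continuous_on_if_smooth_on[OF n(1)] openU, of "- {0}"]
    by (simp add: open_Compl)
  moreover have "p0 \<in> V" using n by (simp add: V_def)
  ultimately obtain e where e: "e > 0"
    and box: "\<And>s t w. \<bar>s - p0$1\<bar> < e \<Longrightarrow> \<bar>t - p0$2\<bar> < e \<Longrightarrow> \<bar>w - p0$3\<bar> < e \<Longrightarrow> vector [s,t,w] \<in> V"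
    using vector_3_in_open by metis
  define J where "J = {s. \<bar>s - p0$1\<bar> < e}"
  have J: "open J" "p0$1 \<in> J"
    using e by (auto simp: J_def intro!: open_Collect_less continuous_intros)
  define c where "c i s = lorentz C (F i s)" for i s
  have V: "vector [s,t,w] \<in> U \<and> n (vector [s,t,w]) \<noteq> 0 \<and> s \<in> I \<and> cos w \<noteq> 0"
    if "s \<in> J" "\<bar>t - p0$2\<bar> < e" "\<bar>w - p0$3\<bar> < e" for s t w
    using box[of s t w] that proj[of "vector [s,t,w]"] cos_nonzero[of "vector [s,t,w]"]
    by (simp add: V_def J_def)
  have JI: "s \<in> I" if "s \<in> J" for s using V[OF that, of "p0$2" "p0$3"] e by simp
  \<comment> \<open>A value of \<open>w\<close> with sin w \<noteq> 0 is fixed so that the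
    \<open>F 4\<close>-component determines \<open>Q\<close>.\<close>
  have "\<exists>w. \<bar>w - p0$3\<bar> < e \<and> sin w \<noteq> 0"
  proof (rule ccontr)
    assume none: "\<not> ?thesis"
    have "0 * cos x + 1 * sin x + 0 = 0" if "\<bar>x - p0$3\<bar> < e" for x
      using none that by auto
    from trig_affine_eq_0(2)[OF e this] show False by simp
  qed
  then obtain w where w: "\<bar>w - p0$3\<bar> < e" "sin w \<noteq> 0" by blast
  have eqs: "\<exists>Q. n (vector [s,t,w]) * c 1 s = 2 * cos w *
       (deriv k1 s * cos t + k1 s * k2 s * sin t) / (r * f (vector [s,t,w]) ^ 3)
    \<and> n (vector [s,t,w]) * c 2 s = 2 * k1 s / (r\<^sup>2 * (f (vector [s,t,w]))\<^sup>2) + Q * cos t * cos w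
    \<and> n (vector [s,t,w]) * c 3 s = Q * sin t * cos w
    \<and> n (vector [s,t,w]) * c 4 s = Q * sin w"
    if "s \<in> J" "\<bar>t - p0$2\<bar> < e" "\<bar>w - p0$3\<bar> < e" for s t w
    using gauss_map_equations[of "vector [s,t,w]", OF _ L] V[OF that] unfolding c_def
    by (metis vector_3)
  have c34: "c 3 s = 0" "c 4 s = 0" if s: "s \<in> J" for s
  proof -
    \<comment> \<open>Eliminating \<open>Q\<close> from the last two components and cancelling
      \<open>n\<close> leaves, for fixed \<open>w\<close>, an affine relation in sin t.\<close>
    have *: "c 3 s * sin w = c 4 s * sin t * cos w" if tw: "\<bar>t - p0$2\<bar> < e" "\<bar>w - p0$3\<bar> < e" for t w
    proof -
      obtain Q where "n (vector [s,t,w]) * c 3 s = Q * sin t * cos w"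
        "n (vector [s,t,w]) * c 4 s = Q * sin w"
        using eqs[OF s tw] by blast
      then have "n (vector [s,t,w]) * (c 3 s * sin w) = n (vector [s,t,w]) * (c 4 s * sin t * cos w)"
        by algebra
      then show ?thesis using V[OF s tw] by simp
    qed
    have "0 * cos t + (- (c 4 s * cos w)) * sin t + c 3 s * sin w = 0" if "\<bar>t - p0$2\<bar> < e" for t
      using *[OF that w(1)] by simp
    note z = trig_affine_eq_0(2,3)[OF e this]
    show "c 3 s = 0" using z(2) w by simp
    show "c 4 s = 0" using z(1) V[OF s, of "p0$2" w] w e by simp
  qed
  \<comment> \<open>Since c_4 = 0 and sin w \<noteq> 0, the \<open>F 4\<close>-component forces
    \<open>Q\<close> to vanish.\<close>
  have Q0: "n (vector [s,t,w]) * c 1 s = 2 * cos w *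
       (deriv k1 s * cos t + k1 s * k2 s * sin t) / (r * f (vector [s,t,w]) ^ 3)
    \<and> n (vector [s,t,w]) * c 2 s = 2 * k1 s / (r\<^sup>2 * (f (vector [s,t,w]))\<^sup>2)"
    if "s \<in> J" "\<bar>t - p0$2\<bar> < e" for s t
    using eqs[OF that w(1)] c34[OF that(1)] w by auto
  have c1k1: "c 1 s * k1 s = 0" if s: "s \<in> J" for s
  proof -
    have "(r * cos w * (c 1 s * k1 s * k1 s - c 2 s * deriv k1 s)) * cos t
        + (- (r * cos w * (c 2 s * k1 s * k2 s))) * sin t + c 1 s * k1 s = 0"
      if t: "\<bar>t - p0$2\<bar> < e" for t
    proof -
      define \<phi> where "\<phi> = f (vector [s,t,w])"
      have \<phi>: "\<phi> \<noteq> 0" using V[OF s t w(1)] f_nonzero by (simp add: \<phi>_def)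
      have \<phi>_eq: "\<phi> = 1 + r * k1 s * cos t * cos w" by (simp add: \<phi>_def f_def)
      define D where "D = deriv k1 s * cos t + k1 s * k2 s * sin t"
      \<comment> \<open>Both sides equal n c_1 c_2, which eliminates the unknown function
        \<open>n\<close>. Clearing denominators leaves a relation affine in cos t and sin t with
        constant term c_1 k_1.\<close>
      have eq: "c 2 s * (2 * cos w * D / (r * \<phi> ^ 3)) = c 1 s * (2 * k1 s / (r\<^sup>2 * \<phi>\<^sup>2))"
        unfolding conjunct1[OF Q0[OF s t], folded \<phi>_def D_def, symmetric]
          conjunct2[OF Q0[OF s t], folded \<phi>_def, symmetric] by (simp only: ac_simps)
      have "c 2 s * r * cos w * D = (r\<^sup>2 * \<phi> ^ 3 / 2) * (c 2 s * (2 * cos w * D / (r * \<phi> ^ 3)))"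
        using \<phi> r_pos by (simp add: power2_eq_square)
      also have "\<dots> = c 1 s * k1 s * \<phi>"
        unfolding eq using \<phi> r_pos by (simp add: power2_eq_square power3_eq_cube)
      finally have "c 2 s * r * cos w * D = c 1 s * k1 s * \<phi>" .
      then show ?thesis unfolding \<phi>_eq D_def by (simp add: algebra_simps)
    qed
    from trig_affine_eq_0(3)[OF e this] show ?thesis .
  qed
  have C0: False if "s \<in> J" "c 1 s = 0" "c 2 s = 0" for s
  proof -
    have "lorentz C (F i s) = 0" for i
      using that c34[OF that(1)] exhaust_4[of i] by (auto simp: c_def)
    then show False using lorentz_orthogonal_frame_eq_0[of "\<lambda>i. F i s" C] frame[OF JI[OF that(1)]] C by simp
  qed
  show False
  proof (cases "\<exists>s\<in>J. k1 s \<noteq> 0")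
    case True
    then obtain s where s: "s \<in> J" "k1 s \<noteq> 0" by blast
    have cont: "continuous_on J k1"
      by (rule continuous_at_imp_continuous_on) (use k1_derivative JI DERIV_isCont in blast)
    define K where "K = J \<inter> k1 -` (- {0})"
    have "open K" unfolding K_def by (rule continuous_open_preimage[OF cont J(1)]) (simp add: open_Compl)
    have K: "s \<in> K" "\<And>x. x \<in> K \<Longrightarrow> c 1 x = 0" using s c1k1 by (auto simp: K_def)
    \<comment> \<open>On the open set \<open>K\<close> the function c_1 vanishes, while the Frenet
      equations give it the derivative k_1 c_2.\<close>
    have "(c 1 has_vector_derivative lorentz C (k1 s *\<^sub>R F 2 s)) (at s)"
      unfolding c_def by (rule bounded_linear.has_vector_derivative[OF bounded_linear_lorentz])
        (rule frenet_equations(2)[OF JI[OF s(1)]])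
    then have "(c 1 has_real_derivative k1 s * c 2 s) (at s)"
      by (simp add: c_def lorentz_simps has_real_derivative_iff_has_vector_derivative)
    then have "((\<lambda>_. 0) has_real_derivative k1 s * c 2 s) (at s)"
      by (rule has_field_derivative_transform_within_open[OF _ \<open>open K\<close> K(1)]) (rule K(2))
    then have "k1 s * c 2 s = 0" by (rule DERIV_unique) simp
    then show False using s C0[of s] K by simp
  next
    case False
    \<comment> \<open>With \<open>k1\<close> zero on all of \<open>J\<close>, its derivative
      vanishes too, so both right-hand sides in \<open>Q0\<close> are zero and \<open>n\<close> can
      be cancelled.\<close>
    have "((\<lambda>_. 0) has_real_derivative deriv k1 (p0$1)) (at (p0$1))"
      by (rule has_field_derivative_transform_within_open[OF k1_derivative[OF JI[OF J(2)]] J])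
        (use False in blast)
    then have "deriv k1 (p0$1) = 0" by (rule DERIV_unique) simp
    moreover have "k1 (p0$1) = 0" using False J(2) by blast
    ultimately have "c 1 (p0$1) = 0" "c 2 (p0$1) = 0"
      using Q0[OF J(2), of "p0$2"] V[OF J(2), of "p0$2" w] w(1) e by simp_all
    then show False using C0[OF J(2)] by blast
  qed
qed

end

theorem theorem1:
  fixes I :: "real set" and \<beta> :: "real \<Rightarrow> real^4" and F :: "4 \<Rightarrow> real \<Rightarrow> real^4"
    and k1 k2 k3 :: "real \<Rightarrow> real" and r :: real and U :: "(real^3) set"
  assumes "open I" and "is_interval I" and "I \<noteq> {}"
    and "timelike_frenet_curve I \<beta> F k1 k2 k3"
    and "r > 0"
    and "open U" and "connected U" and "(\<lambda>p. p$1) ` U = I"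
    and "immersion_on U (tube \<beta> F r)"
  shows "\<not> generalized_L1_1type_gauss_map U (tube \<beta> F r) (tube_normal F)"
proof -
  interpret timelike_tube I \<beta> F k1 k2 k3 r U
    using assms by unfold_locales auto
  show ?thesis by (rule not_generalized_L1_1type)
qed

end
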